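(* Let $\mathcal{I}$ be an ideal on $\omega$. Let $X$ be a compact metric space and let $\mathscr{F}=\{F_\lambda:\lambda\in X\}$ be a rough family of closed subsets of $X$ such that there exist $\eta\in X$ and a sequence $\bm{y}=(y_k:k\in\omega)\in X^\omega$ for which $\lim_k y_k=\eta$ and $y_k\notin F_\eta$ for all $k\in\omega$. Then $\mathcal{I}$ is a $P^+$-ideal if and only if $\Lambda_{\bm{x}}(\mathcal{I},\mathscr{F})=\Gamma_{\bm{x}}(\mathcal{I},\mathscr{F})$ for every $\bm{x}\in X^\omega$.
   Context: $\omega$ is the set of nonnegative integers. An ideal $\mathcal{I}$ on $\omega$ is a family $\mathcal{I}\subseteq\mathcal{P}(\omega)$ closed under subsets and finite unions, containing all finite subsets of $\omega$, and with $\omega\notin\mathcal{I}$. Write $\mathcal{I}^+:=\mathcal{P}(\omega)\setminus\mathcal{I}$; its elements are called $\mathcal{I}$-positive sets. $\mathcal{I}$ is a $P^+$-ideal if for every decreasing sequence $(A_n:n\in\omega)$ of $\mathcal{I}$-positive sets there exists $A\in\mathcal{I}^+$ such that $A\setminus A_n$ is finite for every $n\in\omega$. A rough family on a topological space $X$ is a collection $\mathscr{F}=\{F_\eta:\eta\in X\}$ of subsets of $X$ such that $\eta\in F_\eta$ for all $\eta\in X$. For a sequence $\bm{x}=(x_n:n\in\omega)$ in $X$: $\Gamma_{\bm{x}}(\mathcal{I},\mathscr{F})$ is the set of all $\eta\in X$ such that $\{n\in\omega:x_n\in U\}\notin\mathcal{I}$ for all open sets $U\subseteq X$ with $F_\eta\subseteq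 U$. $\Lambda_{\bm{x}}(\mathcal{I},\mathscr{F})$ is the set of all $\eta\in X$ for which there exists $S\in\mathcal{I}^+$ such that $\{n\in S:x_n\notin U\}$ is finite for all open $U\subseteq X$ with $F_\eta\subseteq U$. *)

theory Defs
  imports "HOL-Analysis.Analysis"
begin

definition ideal_on_omega :: "nat set set \<Rightarrow> bool" where
  "ideal_on_omega I \<longleftrightarrow>
     (\<forall>A B. A \<in> I \<longrightarrow> B \<subseteq> A \<longrightarrow> B \<in> I) \<and>
     (\<forall>A B. A \<in> I \<longrightarrow> B \<in> I \<longrightarrow> A \<union> B \<in> I) \<and>
     (\<forall>A. finite A \<longrightarrow> A \<in> I) \<and>
     UNIV \<notin> I"

definition positive_sets :: "nat set set \<Rightarrow> nat set set" where
  "positive_sets I = UNIV - I"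

text \<open>Decreasing is meant weakly: \<^term>\<open>decseq A\<close> allows repetitions.\<close>

definition P_plus_ideal :: "nat set set \<Rightarrow> bool" where
  "P_plus_ideal I \<longleftrightarrow>
     ideal_on_omega I \<and>
     (\<forall>A :: nat \<Rightarrow> nat set. decseq A \<longrightarrow> (\<forall>n. A n \<in> positive_sets I) \<longrightarrow>
        (\<exists>B \<in> positive_sets I. \<forall>n. finite (B - A n)))"

text \<open>Families are functions on the whole type; only their values on \<^term>\<open>topspace X\<close> matter.\<close>

definition rough_family :: "'a topology \<Rightarrow> ('a \<Rightarrow> 'a set) \<Rightarrow> bool" where
  "rough_family X F \<longleftrightarrow> (\<forall>\<eta> \<in> topspace X. F \<eta> \<subseteq> topspace X \<and> \<eta> \<in> F \<eta>)"

definition rough_cluster_points ::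
  "'a topology \<Rightarrow> nat set set \<Rightarrow> ('a \<Rightarrow> 'a set) \<Rightarrow> (nat \<Rightarrow> 'a) \<Rightarrow> 'a set" where
  "rough_cluster_points X I F x =
     {\<eta> \<in> topspace X. \<forall>U. openin X U \<longrightarrow> F \<eta> \<subseteq> U \<longrightarrow> {n. x n \<in> U} \<notin> I}"

definition rough_limit_points ::
  "'a topology \<Rightarrow> nat set set \<Rightarrow> ('a \<Rightarrow> 'a set) \<Rightarrow> (nat \<Rightarrow> 'a) \<Rightarrow> 'a set" where
  "rough_limit_points X I F x =
     {\<eta> \<in> topspace X. \<exists>S \<in> positive_sets I.
        \<forall>U. openin X U \<longrightarrow> F \<eta> \<subseteq> U \<longrightarrow> finite {n \<in> S. x n \<notin> U}}"

end

theory Submission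
  imports Defs
begin

text \<open>A compact set has a countable neighbourhood base, given by its \<open>1/(n+1)\<close>-enlargements, so
  the \<open>P\<^sup>+\<close>-property turns a rough cluster point into a rough limit point. Conversely, for
  positive sets \<open>A\<^sub>0 \<supseteq> A\<^sub>1 \<supseteq> \<dots>\<close> put \<open>x\<^sub>n = y\<^sub>k\<close> for \<open>n \<in> A\<^sub>k - A\<^sub>k\<^sub>+\<^sub>1\<close>: since
  \<open>y\<^sub>k\<close> tends to \<open>\<eta> \<in> F\<^sub>\<eta>\<close>, the point \<open>\<eta>\<close> is a rough cluster point, and any set \<open>S\<close> witnessing
  that it is a rough limit point is a pseudo-intersection of the \<open>A\<^sub>k\<close>, because the complement of
  \<open>{y\<^sub>0, \<dots>, y\<^sub>k}\<close> is an open set containing \<open>F\<^sub>\<eta>\<close>.\<close>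

text \<open>If the index set of \<open>U\<close> were in the ideal, adding the finitely many
  exceptional indices of the witness \<open>S\<close> would keep it there, yet the union covers the
  positive set \<open>S\<close>.\<close>

lemma rough_limit_points_subset_cluster_points:
  assumes "ideal_on_omega I"
  shows "rough_limit_points X I F x \<subseteq> rough_cluster_points X I F x"
proof -
  have "{n. x n \<in> U} \<notin> I" if "S \<notin> I" "finite {n \<in> S. x n \<notin> U}" for S U
  proof
    assume "{n. x n \<in> U} \<in> I"
    moreover have "{n \<in> S. x n \<notin> U} \<in> I"
      using assms that(2) unfolding ideal_on_omega_def by blast
    ultimately have "{n. x n \<in> U} \<union> {n \<in> S. x n \<notin> U} \<in> I"
      using assms unfolding ideal_on_omega_def by blast
    moreover have "S \<subseteq> {n. x n \<in> U} \<union> {n \<in> S. x n \<notin> U}"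
      by blast
    ultimately show False
      using assms that(1) unfolding ideal_on_omega_def by blast
  qed
  then show ?thesis
    unfolding rough_limit_points_def rough_cluster_points_def positive_sets_def by blast
qed

context Metric_space
begin

lemma rough_cluster_points_subset_limit_points:
  assumes I: "P_plus_ideal I"
    and F: "\<And>\<xi>. \<xi> \<in> M \<Longrightarrow> compactin mtopology (F \<xi>)"
  shows "rough_cluster_points mtopology I F x \<subseteq> rough_limit_points mtopology I F x"
proof
  fix \<eta> assume \<eta>: "\<eta> \<in> rough_cluster_points mtopology I F x"
  then have "\<eta> \<in> M"
    by (simp add: rough_cluster_points_def)
  then have compact: "compactin mtopology (F \<eta>)"
    by (rule F)
  then have "F \<eta> \<subseteq> M"
    using compactin_subset_topspace by fastforce
  define V where "V n = (\<Union>q \<in> F \<eta>. mball q (1 / real (Suc n)))" for n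
  have V_open: "openin mtopology (V n)" for n
    unfolding V_def by (rule openin_Union) auto
  have V_superset: "F \<eta> \<subseteq> V n" for n
  proof
    fix q assume q: "q \<in> F \<eta>"
    with \<open>F \<eta> \<subseteq> M\<close> have "q \<in> mball q (1 / real (Suc n))"
      by (subst centre_in_mball_iff) auto
    with q show "q \<in> V n"
      unfolding V_def by blast
  qed
  have V_dec: "V n \<subseteq> V m" if "m \<le> n" for m n
    unfolding V_def using that by (intro UN_mono order_refl mball_subset_concentric) (simp add: field_simps)
  define A where "A n = {k. x k \<in> V n}" for n
  have "decseq A"
    using V_dec by (auto simp: decseq_def A_def)
  moreover have "A n \<in> positive_sets I" for n
    using \<eta> V_open V_superset by (auto simp: rough_cluster_points_def positive_sets_def A_def)
  \<comment> \<open>\<open>B\<close> will witness the limit point: for each \<open>n\<close>, all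
    but finitely many of its indices send \<open>x\<close> into \<open>V n\<close>.\<close>
  ultimately obtain B where B: "B \<in> positive_sets I" "\<And>n. finite (B - A n)"
    using I unfolding P_plus_ideal_def by blast
  have "finite {n \<in> B. x n \<notin> U}" if "openin mtopology U" "F \<eta> \<subseteq> U" for U
  proof -
    \<comment> \<open>The Lebesgue number lemma for the one-set cover \<open>{U}\<close> gives a
      single radius that works at every point of \<open>F \<eta>\<close>; hence some
      \<open>V n\<close> lies inside \<open>U\<close>.\<close>
    have "\<exists>\<epsilon>>0. \<forall>q \<in> F \<eta>. \<exists>W \<in> {U}. mball q \<epsilon> \<subseteq> W"
      using that by (intro lebesgue_number[OF compact]) auto
    then obtain \<epsilon> where "\<epsilon> > 0" and \<epsilon>: "\<forall>q \<in> F \<eta>. mball q \<epsilon> \<subseteq> U"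
      by auto
    obtain n where n: "1 / real (Suc n) < \<epsilon>"
      using \<open>\<epsilon> > 0\<close> by (rule nat_approx_posE)
    have "V n \<subseteq> U"
      unfolding V_def
    proof (rule UN_least)
      fix q assume "q \<in> F \<eta>"
      then show "mball q (1 / real (Suc n)) \<subseteq> U"
        using mball_subset_concentric[OF less_imp_le[OF n]] \<epsilon> by blast
    qed
    then have "{n \<in> B. x n \<notin> U} \<subseteq> B - A n"
      by (auto simp: A_def)
    then show ?thesis
      using B(2) finite_subset by blast
  qed
  then show "\<eta> \<in> rough_limit_points mtopology I F x"
    using \<open>\<eta> \<in> M\<close> B(1) by (auto simp: rough_limit_points_def)
qed

end

text \<open>The T1 axiom is what allows finitely many of the values \<open>y j\<close> to be removed
  from the space while leaving an open superset of \<open>F \<eta>\<close>.\<close>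

lemma pseudo_intersection_from_rough_points:
  assumes I: "ideal_on_omega I"
    and "t1_space X"
    and F: "F \<eta> \<subseteq> topspace X" "\<eta> \<in> F \<eta>"
    and y: "range y \<subseteq> topspace X" "limitin X y \<eta> sequentially" "\<And>k. y k \<notin> F \<eta>"
    and eq: "\<And>x. range x \<subseteq> topspace X \<Longrightarrow>
      rough_cluster_points X I F x \<subseteq> rough_limit_points X I F x"
    and A: "decseq A" "\<And>n. A n \<in> positive_sets I"
  shows "\<exists>B \<in> positive_sets I. \<forall>n. finite (B - A n)"
proof -
  \<comment> \<open>For \<open>n\<close> in \<open>A 0\<close> but not in every \<open>A k\<close>,
    the least \<open>j\<close> is the last index with \<open>n\<close> in \<open>A j\<close>; an
    \<open>n\<close> outside \<open>A 0\<close> gets \<open>y 0\<close>. If \<open>n\<close> lies in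
    every \<open>A k\<close>, the default \<eta> is harmless, since it belongs to every open
    superset of \<open>F \<eta>\<close>.\<close>
  define x where "x n = (if \<forall>k. n \<in> A k then \<eta> else y (LEAST j. n \<notin> A (Suc j)))" for n
  have x_tail: "x n = \<eta> \<or> (\<exists>j\<ge>K. x n = y j)" if "n \<in> A K" for n K
  proof (cases "\<forall>k. n \<in> A k")
    case False
    then obtain k where "n \<notin> A k"
      by blast
    then have "n \<notin> A (Suc k)"
      using decseqD[OF A(1), of k "Suc k"] by auto
    then have least: "n \<notin> A (Suc (LEAST j. n \<notin> A (Suc j)))"
      by (rule LeastI)
    \<comment> \<open>Otherwise monotonicity would carry \<open>n\<close> from \<open>A K\<close>
      into a set that excludes it.\<close>
    then have "K < Suc (LEAST j. n \<notin> A (Suc j))"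
      using decseqD[OF A(1), of "Suc (LEAST j. n \<notin> A (Suc j))" K] that by force
    then have "K \<le> (LEAST j. n \<notin> A (Suc j))"
      by simp
    then show ?thesis
      using False unfolding x_def by metis
  qed (simp add: x_def)
  have x_head: "x n \<in> y ` {..k}" if "n \<notin> A (Suc k)" for n k
    using that Least_le[of "\<lambda>j. n \<notin> A (Suc j)" k] by (auto simp: x_def)
  have "range x \<subseteq> topspace X"
    using F y(1) by (auto simp: x_def)
  moreover have "\<eta> \<in> rough_cluster_points X I F x"
  proof -
    have "{n. x n \<in> U} \<notin> I" if "openin X U" "F \<eta> \<subseteq> U" for U
    proof -
      have "\<eta> \<in> U"
        using F that by blast
      then obtain K where "\<And>j. j \<ge> K \<Longrightarrow> y j \<in> U"
        using y(2) \<open>openin X U\<close> unfolding limitin_sequentially by blast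
      then have "A K \<subseteq> {n. x n \<in> U}"
        using x_tail[of _ K] \<open>\<eta> \<in> U\<close> by fastforce
      then show ?thesis
        using I A(2)[of K] unfolding ideal_on_omega_def positive_sets_def by blast
    qed
    then show ?thesis
      using F by (auto simp: rough_cluster_points_def)
  qed
  ultimately have "\<eta> \<in> rough_limit_points X I F x"
    using eq by blast
  then obtain S where S: "S \<in> positive_sets I"
      "\<And>U. openin X U \<Longrightarrow> F \<eta> \<subseteq> U \<Longrightarrow> finite {n \<in> S. x n \<notin> U}"
    by (auto simp: rough_limit_points_def)
  have "finite (S - A k)" for k
  proof -
    have "closedin X (y ` {..k})"
      using \<open>t1_space X\<close> y(1) by (auto simp: t1_space_closedin_finite)
    then have "finite {n \<in> S. x n \<notin> topspace X - y ` {..k}}"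
      using F y(3) by (intro S(2)) auto
    \<comment> \<open>Missing \<open>A k\<close> implies missing \<open>A (Suc k)\<close>, which is
      the form \<open>x_head\<close> needs; this also covers \<open>k = 0\<close>.\<close>
    moreover have "S - A k \<subseteq> {n \<in> S. x n \<notin> topspace X - y ` {..k}}"
      using x_head decseqD[OF A(1), of k "Suc k"] by fastforce
    ultimately show ?thesis
      by (rule rev_finite_subset)
  qed
  with S(1) show ?thesis
    by blast
qed

theorem theorem2p20:
  fixes I :: "nat set set"
    and X :: "'a set" and d :: "'a \<Rightarrow> 'a \<Rightarrow> real"
    and F :: "'a \<Rightarrow> 'a set"
  assumes "ideal_on_omega I"
    and "Metric_space X d"
    and "compact_space (Metric_space.mtopology X d)"
    and "rough_family (Metric_space.mtopology X d) F"
    and "\<forall>\<xi> \<in> X. closedin (Metric_space.mtopology X d) (F \<xi>)"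
    and "\<exists>\<eta> \<in> X. \<exists>y :: nat \<Rightarrow> 'a. range y \<subseteq> X \<and>
           limitin (Metric_space.mtopology X d) y \<eta> sequentially \<and> (\<forall>k. y k \<notin> F \<eta>)"
  shows "P_plus_ideal I \<longleftrightarrow>
    (\<forall>x :: nat \<Rightarrow> 'a. range x \<subseteq> X \<longrightarrow>
       rough_limit_points (Metric_space.mtopology X d) I F x =
       rough_cluster_points (Metric_space.mtopology X d) I F x)"
proof -
  interpret Metric_space X d
    by (fact assms(2))
  \<comment> \<open>Compactness of the space and closedness of the values enter the forward
    direction through this fact.\<close>
  have F_compact: "compactin mtopology (F \<xi>)" if "\<xi> \<in> X" for \<xi>
    using assms(3,5) that closedin_compact_space by blast
  obtain \<eta> y where \<eta>: "\<eta> \<in> X" and y: "range y \<subseteq> X" "limitin mtopology y \<eta> sequentially"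
      "\<And>k. y k \<notin> F \<eta>"
    using assms(6) by blast
  have F: "F \<eta> \<subseteq> topspace mtopology" "\<eta> \<in> F \<eta>"
    using assms(4) \<eta> unfolding rough_family_def by auto
  have "t1_space mtopology"
    by (simp add: Hausdorff_imp_t1_space Hausdorff_space_mtopology)
  show ?thesis
  proof
    assume "P_plus_ideal I"
    then show "\<forall>x. range x \<subseteq> X \<longrightarrow>
        rough_limit_points mtopology I F x = rough_cluster_points mtopology I F x"
      by (intro allI impI equalityI rough_limit_points_subset_cluster_points[OF assms(1)]
          rough_cluster_points_subset_limit_points F_compact)
  next
    assume eq: "\<forall>x. range x \<subseteq> X \<longrightarrow>
        rough_limit_points mtopology I F x = rough_cluster_points mtopology I F x"
    have "\<exists>B \<in> positive_sets I. \<forall>n. finite (B - A n)"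
      if "decseq A" "\<forall>n. A n \<in> positive_sets I" for A
    proof (rule pseudo_intersection_from_rough_points
        [where F = F and \<eta> = \<eta> and y = y, OF assms(1) \<open>t1_space mtopology\<close> F _ y(2,3) _ that(1)])
      show "rough_cluster_points mtopology I F x \<subseteq> rough_limit_points mtopology I F x"
        if "range x \<subseteq> topspace mtopology" for x
        using eq that by simp
    qed (use y(1) that(2) in simp_all)
    then show "P_plus_ideal I"
      using assms(1) by (simp add: P_plus_ideal_def)
  qed
qed

end
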